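(* Let $n\ge 2$, let $\Omega\subseteq\mathbb{R}^n$ be open and connected, and let $u:\Omega\to\mathbb{R}$ be a harmonic function with no critical points in $\Omega$ (i.e. $\nabla u(q)\neq 0$ for every $q\in\Omega$). Put $\mathbf{N}=\nabla u/\|\nabla u\|$ on $\Omega$, and for $q\in\Omega$ let $H(q)$ be the mean curvature at $q$, with respect to the unit normal field $\mathbf{N}$, of the level hypersurface $S_{u(q)}=\{x\in\Omega \mid u(x)=u(q)\}$. Let $p_0\in\Omega$, let $p$ be a point on the gradient flow of $u$ originating from $p_0$, and let $\overset{\frown}{p_0p}$ be the arc of the flow between $p_0$ and $p$. Then $$\|\nabla u(p)\|=\|\nabla u(p_0)\|\,\exp\left((n-1)\int_{\overset{\frown}{p_0p}}H\,ds\right),$$ where $s$ denotes arc length along $\overset{\frown}{p_0p}$.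
   Context: Gradient flow: the gradient flow originating from $p_0$ is parametrized at unit speed as the curve $\varphi$ in $\Omega$ with $\varphi'(s)=\mathbf{N}(\varphi(s))$ and $\varphi(0)=p_0$. That $p$ lies on this flow means $p=\varphi(\ell)$ for some $\ell\ge 0$ such that $\varphi$ is defined on $[0,\ell]$. The arc $\overset{\frown}{p_0p}$ is $\varphi([0,\ell])$, and $\int_{\overset{\frown}{p_0p}}H\,ds=\int_0^\ell H(\varphi(s))\,ds$. Mean curvature and sign convention: let $S=S_{u(q)}$ be the level hypersurface of $u$ through $q$, oriented by the unit normal $\mathbf{N}=\nabla u/\|\nabla u\|$, and let $T_qS=\mathbf{N}(q)^{\perp}$ be its tangent space at $q$. For a unit vector $\mathbf{v}\in T_qS$, let $\gamma_{\mathbf{v}}$ be the unit-speed parametrization of the normal section of $S$ at $q$ in direction $\mathbf{v}$ (the curve cut out near $q$ on $S$ by the affine plane through $q$ spanned by $\mathbf{v}$ and $\mathbf{N}(q)$), with $\gamma_{\mathbf{v}}(0)=q$ and $\gamma_{\mathbf{v}}'(0)=\mathbf{v}$. The signed normal curvature $\kappa_q(\mathbf{v})$ is defined by $\gamma_{\mathbf{v}}''(0)=\kappa_q(\mathbf{v})\,\mathbf{N}(q)$. The mean curvature $H(q)$ is the average of $\kappa_q(\mathbf{v})$ over the unit sphere $\{\mathbf{v}\in T_qS:\|\mathbf{v}\|=1\}$, of dimension $n-2$, with respect to its standard surface measure. For $n=3$ this is $H(q)=\frac{1}{2\pi}\int_{\|\mathbf{v}\|=1}\kappa_q(\mathbf{v})\,d\sigma$.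 For $n=2$ the unit sphere consists of two points and $H(q)$ is the signed curvature of the level curve with respect to $\mathbf{N}$. *)

theory Defs
  imports "HOL-Analysis.Analysis"
begin

section \<open>Harmonic functions\<close>

text \<open>Functions on an open set \<open>\<Omega>\<close> are represented by total functions whose values
  outside \<open>\<Omega>\<close> are irrelevant.\<close>

definition grad :: "('a::euclidean_space \<Rightarrow> real) \<Rightarrow> 'a \<Rightarrow> 'a" where
  "grad u x = (THE D. GDERIV u x :> D)"

definition C2_on :: "'a::euclidean_space set \<Rightarrow> ('a \<Rightarrow> real) \<Rightarrow> bool" where
  "C2_on \<Omega> u \<longleftrightarrow>
    (\<exists>(g :: 'a \<Rightarrow> 'a) (h :: 'a \<Rightarrow> 'a \<Rightarrow>\<^sub>L 'a).
       (\<forall>x\<in>\<Omega>. GDERIV u x :> g x \<and> (g has_derivative blinfun_apply (h x)) (at x)) \<and>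
       continuous_on \<Omega> h)"

definition partial_deriv :: "'a::euclidean_space \<Rightarrow> ('a \<Rightarrow> real) \<Rightarrow> 'a \<Rightarrow> real" where
  "partial_deriv b u x = deriv (\<lambda>t. u (x + t *\<^sub>R b)) 0"

definition laplacian :: "('a::euclidean_space \<Rightarrow> real) \<Rightarrow> 'a \<Rightarrow> real" where
  "laplacian u x = (\<Sum>b\<in>Basis. partial_deriv b (partial_deriv b u) x)"

definition harmonic_on :: "'a::euclidean_space set \<Rightarrow> ('a \<Rightarrow> real) \<Rightarrow> bool" where
  "harmonic_on \<Omega> u \<longleftrightarrow> C2_on \<Omega> u \<and> (\<forall>x\<in>\<Omega>. laplacian u x = 0)"

section \<open>Surface measure on the unit sphere of a subspace\<close>

definition onb :: "'a::euclidean_space set \<Rightarrow> 'a set" where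
  "onb V = (SOME B. B \<subseteq> V \<and> pairwise orthogonal B \<and> (\<forall>b\<in>B. norm b = 1) \<and> span B = V)"

text \<open>Lebesgue measure of dimension \<open>dim V\<close> on a linear subspace \<open>V\<close>, viewed as a measure on
  the ambient space. It is constructed as \<open>lborel\<close> is, with \<open>Basis\<close> replaced by an
  orthonormal basis of \<open>V\<close>; it does not depend on which basis is chosen.\<close>

definition subspace_lborel :: "'a::euclidean_space set \<Rightarrow> 'a measure" where
  "subspace_lborel V =
     distr (\<Pi>\<^sub>M b\<in>onb V. (lborel :: real measure)) borel (\<lambda>f. \<Sum>b\<in>onb V. f b *\<^sub>R b)"

definition unit_sphere :: "'a::euclidean_space set \<Rightarrow> 'a set" where
  "unit_sphere V = {v \<in> V. norm v = 1}"

text \<open>The standard surface measure (of dimension \<open>dim V - 1\<close>) on the unit sphere of \<open>V\<close>, given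
  by polar coordinates: the measure of \<open>A\<close> is \<open>dim V\<close> times the Lebesgue measure in \<open>V\<close> of the
  cone \<open>{r *\<^sub>R a | r a. 0 < r \<le> 1 \<and> a \<in> A}\<close>. For \<open>dim V = 1\<close> this is the counting measure on
  the two unit vectors of \<open>V\<close>.\<close>

definition sphere_measure :: "'a::euclidean_space set \<Rightarrow> 'a measure" where
  "sphere_measure V =
     scale_measure (of_nat (dim V))
       (distr (restrict_space (subspace_lborel V) (cball 0 1)) borel sgn)"

section \<open>Mean curvature of level hypersurfaces\<close>

definition level_set :: "'a set \<Rightarrow> ('a \<Rightarrow> real) \<Rightarrow> 'a \<Rightarrow> 'a set" where
  "level_set \<Omega> u q = {x \<in> \<Omega>. u x = u q}"

definition unit_normal :: "('a::euclidean_space \<Rightarrow> real) \<Rightarrow> 'a \<Rightarrow> 'a" where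
  "unit_normal u q = grad u q /\<^sub>R norm (grad u q)"

definition tangent_space :: "('a::euclidean_space \<Rightarrow> real) \<Rightarrow> 'a \<Rightarrow> 'a set" where
  "tangent_space u q = {v. v \<bullet> unit_normal u q = 0}"

text \<open>\<open>\<gamma>\<close>, with velocity \<open>\<gamma>'\<close>, is a unit-speed parametrization near \<open>q\<close> of the section of the
  level set by the affine plane through \<open>q\<close> spanned by \<open>v\<close> and the normal, starting in
  direction \<open>v\<close>.\<close>

definition normal_section ::
  "'a::euclidean_space set \<Rightarrow> ('a \<Rightarrow> real) \<Rightarrow> 'a \<Rightarrow> 'a \<Rightarrow> (real \<Rightarrow> 'a) \<Rightarrow> (real \<Rightarrow> 'a) \<Rightarrow> bool" where
  "normal_section \<Omega> u q v \<gamma> \<gamma>' \<longleftrightarrow>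
     \<gamma> 0 = q \<and> \<gamma>' 0 = v \<and>
     (\<exists>e>0. \<exists>U. open U \<and>
        \<gamma> ` {-e<..<e} = level_set \<Omega> u q \<inter> (\<lambda>w. q + w) ` span {v, unit_normal u q} \<inter> U \<and>
        (\<forall>t\<in>{-e<..<e}. (\<gamma> has_vector_derivative \<gamma>' t) (at t) \<and> norm (\<gamma>' t) = 1))"

definition normal_curvature ::
  "'a::euclidean_space set \<Rightarrow> ('a \<Rightarrow> real) \<Rightarrow> 'a \<Rightarrow> 'a \<Rightarrow> real" where
  "normal_curvature \<Omega> u q v =
     (THE k. \<exists>\<gamma> \<gamma>'. normal_section \<Omega> u q v \<gamma> \<gamma>' \<and>
               (\<gamma>' has_vector_derivative k *\<^sub>R unit_normal u q) (at 0))"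

definition mean_curvature :: "'a::euclidean_space set \<Rightarrow> ('a \<Rightarrow> real) \<Rightarrow> 'a \<Rightarrow> real" where
  "mean_curvature \<Omega> u q =
     (let T = tangent_space u q; \<sigma> = sphere_measure T in
       (LINT v:unit_sphere T|\<sigma>. normal_curvature \<Omega> u q v) / measure \<sigma> (unit_sphere T))"

section \<open>Gradient flow\<close>

text \<open>Unit-speed flow on \<open>[0, l]\<close>; the derivatives at the two end points are one-sided.\<close>

definition gradient_flow ::
  "'a::euclidean_space set \<Rightarrow> ('a \<Rightarrow> real) \<Rightarrow> 'a \<Rightarrow> real \<Rightarrow> (real \<Rightarrow> 'a) \<Rightarrow> bool" where
  "gradient_flow \<Omega> u p0 l \<phi> \<longleftrightarrow>
     \<phi> 0 = p0 \<and>
     (\<forall>s\<in>{0..l}. \<phi> s \<in> \<Omega> \<and>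
        (\<phi> has_vector_derivative unit_normal u (\<phi> s)) (at s within {0..l}))"

end

theory Submission
  imports Defs
begin

text \<open>Write \<open>g\<close> for the gradient of \<open>u\<close>, \<open>h\<close> for its derivative (the Hessian as an operator) and
  \<open>N = g / norm g\<close>. The theorem is the equality of two expressions for the logarithmic derivative
  of \<open>norm g\<close> along the flow.

  On the one hand, \<open>\<phi>' = N\<close> gives \<open>(ln (norm (g \<circ> \<phi>)))' = (h N \<bullet> N) / norm g\<close> by the chain rule.
  On the other hand, differentiating \<open>u (\<gamma> t) = u q\<close> twice along a normal section \<open>\<gamma>\<close> with
  direction \<open>v\<close> gives \<open>h v \<bullet> v + k * norm g = 0\<close>, so the normal curvature is the quadratic form
  \<open>k = - (h v \<bullet> v) / norm g\<close> (\<open>normal_curvature_eq\<close>). The average of a quadratic form over a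
  unit sphere is its trace divided by the dimension (\<open>sphere_average_quadratic\<close>), so
  \<open>n - 1\<close> times the mean curvature is \<open>- (trace of h on the tangent space) / norm g\<close>. Since \<open>u\<close>
  is harmonic, the full trace of \<open>h\<close> vanishes, and what is left is again \<open>(h N \<bullet> N) / norm g\<close>
  (\<open>mean_curvature_trace_free\<close>). Integrating over \<open>{0..l}\<close> and exponentiating finishes the proof.
  The gauge integral integrates every derivative, so the integrability of the mean curvature along
  the flow comes with the value of the integral.

  The normal curvature is defined by a definite description, so a normal section must also be
  shown to exist: in the normal plane the level set is a graph over the tangent
  direction (\<open>implicit_graph\<close>), which is then reparametrized by arc length
  (\<open>arclength_parameter\<close>).\<close>

section \<open>Plane curves: implicit graphs and arc length\<close>

text \<open>The map \<open>(x, y) \<mapsto> (x, F (x, y))\<close> is injective on a box where \<open>F2 > 0\<close>, so by invariance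
  of domain its image is open, and its inverse is differentiable; \<open>\<eta> x\<close> is the second component
  of the preimage of \<open>(x, F 0)\<close>. The equivalence on the whole box matters because a normal section
  must fill the level set within a neighbourhood.\<close>

lemma implicit_graph:
  fixes F F1 F2 :: "real \<times> real \<Rightarrow> real"
  assumes "open W" "0 \<in> W"
    and der: "\<And>z. z \<in> W \<Longrightarrow> (F has_derivative (\<lambda>w. fst w * F1 z + snd w * F2 z)) (at z)"
    and cont: "continuous_on W F2" and pos0: "F2 0 > 0"
  obtains a b \<eta> where "a > 0" "b > 0" "{-a<..<a} \<times> {-b<..<b} \<subseteq> W"
    and "\<And>z. z \<in> {-a<..<a} \<times> {-b<..<b} \<Longrightarrow> F2 z > 0"
    and "\<And>x. \<bar>x\<bar> < a \<Longrightarrow> \<bar>\<eta> x\<bar> < b"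
    and "\<And>x y. \<bar>x\<bar> < a \<Longrightarrow> \<bar>y\<bar> < b \<Longrightarrow> F (x, y) = F 0 \<longleftrightarrow> y = \<eta> x"
    and "\<And>x. \<bar>x\<bar> < a \<Longrightarrow> (\<eta> has_real_derivative - F1 (x, \<eta> x) / F2 (x, \<eta> x)) (at x)"
proof -
  define W' where "W' = W \<inter> F2 -` {0<..}"
  have "open W'"
    unfolding W'_def using cont \<open>open W\<close> by (auto intro: continuous_open_preimage)
  moreover have "(0, 0) \<in> W'" using \<open>0 \<in> W\<close> pos0 by (simp add: W'_def zero_prod_def)
  ultimately obtain A B where AB: "open A" "open B" "0 \<in> A" "0 \<in> B" "A \<times> B \<subseteq> W'"
    by (metis open_prod_elim mem_Sigma_iff)
  obtain r1 where r1: "r1 > 0" "ball 0 r1 \<subseteq> A" using AB openE by blast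
  obtain r2 where r2: "r2 > 0" "ball 0 r2 \<subseteq> B" using AB openE by blast
  define Q where "Q = {-r1<..<r1} \<times> {-r2<..<r2}"
  have ball: "{-r<..<r} = ball 0 r" for r :: real by (auto simp: dist_real_def)
  have QW: "Q \<subseteq> W" and posQ: "\<And>z. z \<in> Q \<Longrightarrow> F2 z > 0"
  proof -
    have "Q \<subseteq> A \<times> B" using r1 r2 unfolding Q_def ball by blast
    then have "Q \<subseteq> W'" using AB by blast
    then show "Q \<subseteq> W" and "\<And>z. z \<in> Q \<Longrightarrow> F2 z > 0" unfolding W'_def by auto
  qed
  have "open Q" "0 \<in> Q" using r1 r2 by (auto simp: Q_def zero_prod_def open_Times)
  have Q_iff: "(x, y) \<in> Q \<longleftrightarrow> \<bar>x\<bar> < r1 \<and> \<bar>y\<bar> < r2" for x y by (auto simp: Q_def)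
  define \<Phi> where "\<Phi> = (\<lambda>z. (fst z, F z))"
  have d\<Phi>: "(\<Phi> has_derivative (\<lambda>w. (fst w, fst w * F1 z + snd w * F2 z))) (at z)" if "z \<in> Q" for z
    unfolding \<Phi>_def using that QW
    by (intro has_derivative_Pair has_derivative_fst has_derivative_ident der) auto
  have c\<Phi>: "continuous_on Q \<Phi>"
    using d\<Phi> has_derivative_continuous continuous_at_imp_continuous_on by blast
  have mono: "F (x, y) < F (x, y')" if "\<bar>x\<bar> < r1" "\<bar>y\<bar> < r2" "\<bar>y'\<bar> < r2" "y < y'" for x y y'
  proof (rule DERIV_pos_imp_increasing[OF \<open>y < y'\<close>])
    fix t assume t: "y \<le> t" "t \<le> y'"
    then have Q: "(x, t) \<in> Q" using that by (auto simp: Q_def)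
    have 1: "((\<lambda>t. (x, t)) has_derivative (\<lambda>w. (0, w))) (at t)"
      by (auto intro!: derivative_eq_intros)
    have 2: "(F has_derivative (\<lambda>w. fst w * F1 (x,t) + snd w * F2 (x,t))) (at (x, t))"
      using Q QW der by blast
    have "((\<lambda>t. F (x, t)) has_derivative (\<lambda>w. fst (0, w) * F1 (x,t) + snd (0::real, w) * F2 (x,t))) (at t)"
      using has_derivative_compose[OF 1 2] .
    then have "((\<lambda>t. F (x, t)) has_real_derivative F2 (x,t)) (at t)"
      by (simp add: has_field_derivative_def mult_commute_abs)
    with posQ[OF Q] show "\<exists>d. ((\<lambda>t. F (x, t)) has_real_derivative d) (at t) \<and> 0 < d" by blast
  qed
  have inj: "inj_on \<Phi> Q"
  proof (rule inj_onI)
    fix z z' assume "z \<in> Q" "z' \<in> Q" "\<Phi> z = \<Phi> z'"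
    moreover obtain x y y' where "z = (x, y)" "z' = (x, y')"
      using \<open>\<Phi> z = \<Phi> z'\<close> by (cases z; cases z') (auto simp: \<Phi>_def)
    ultimately show "z = z'"
      using mono[of x y y'] mono[of x y' y] by (cases y y' rule: linorder_cases; auto simp: \<Phi>_def Q_iff)
  qed
  define G where "G = inv_into Q \<Phi>"
  have G: "G (\<Phi> z) = z" if "z \<in> Q" for z using that inj by (simp add: G_def)
  have "open (\<Phi> ` Q)" by (rule invariance_of_domain[OF c\<Phi> \<open>open Q\<close> inj])
  then have "open ((\<lambda>x. (x, F 0)) -` (\<Phi> ` Q))"
    by (intro open_vimage continuous_intros)
  moreover have "\<Phi> 0 = (0, F 0)" by (simp add: \<Phi>_def)
  then have "0 \<in> (\<lambda>x. (x, F 0)) -` (\<Phi> ` Q)" using \<open>0 \<in> Q\<close> by (metis imageI vimageI)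
  ultimately obtain a0 where a0: "a0 > 0" "ball 0 a0 \<subseteq> (\<lambda>x. (x, F 0)) -` (\<Phi> ` Q)"
    using openE by blast
  define a where "a = min a0 r1"
  define \<eta> where "\<eta> = (\<lambda>x. snd (G (x, F 0)))"
  have key: "(x, \<eta> x) \<in> Q \<and> \<Phi> (x, \<eta> x) = (x, F 0)" if "\<bar>x\<bar> < a" for x
  proof -
    have "x \<in> ball 0 a0" using that by (auto simp: a_def)
    then obtain z where z: "z \<in> Q" "\<Phi> z = (x, F 0)" using a0(2) by force
    then have "G (x, F 0) = z" using G by metis
    moreover have "fst z = x" using z by (simp add: \<Phi>_def)
    ultimately have "z = (x, \<eta> x)" by (simp add: \<eta>_def prod_eq_iff)
    with z show ?thesis by auto
  qed
  show thesis
  proof (rule that[of a r2 \<eta>])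
    show "a > 0" using a0 r1 by (simp add: a_def)
    show "r2 > 0" by fact
    have sub: "{-a<..<a} \<times> {-r2<..<r2} \<subseteq> Q" by (auto simp: Q_def a_def)
    then show "{-a<..<a} \<times> {-r2<..<r2} \<subseteq> W" using QW by auto
    show "\<And>z. z \<in> {-a<..<a} \<times> {-r2<..<r2} \<Longrightarrow> F2 z > 0" using sub posQ by blast
    show "\<bar>\<eta> x\<bar> < r2" if "\<bar>x\<bar> < a" for x using key[OF that] by (auto simp: Q_def)
    show "F (x, y) = F 0 \<longleftrightarrow> y = \<eta> x" if "\<bar>x\<bar> < a" "\<bar>y\<bar> < r2" for x y
    proof -
      have "(x, y) \<in> Q" using that by (auto simp: Q_def a_def)
      then show ?thesis using key[OF that(1)] inj
        by (auto simp: \<Phi>_def dest: inj_onD[of _ _ "(x,y)" "(x, \<eta> x)"])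
    qed
    show "(\<eta> has_real_derivative - F1 (x, \<eta> x) / F2 (x, \<eta> x)) (at x)" if "\<bar>x\<bar> < a" for x
    proof -
      let ?z = "(x, \<eta> x)"
      have z: "?z \<in> Q" "\<Phi> ?z = (x, F 0)" using key[OF that] by auto
      have dG: "(G has_derivative (\<lambda>w. (fst w, (snd w - fst w * F1 ?z) / F2 ?z))) (at (x, F 0))"
        unfolding z(2)[symmetric] using posQ[OF z(1)]
        by (intro has_derivative_inverse_strong[OF \<open>open Q\<close> z(1) c\<Phi> G d\<Phi>[OF z(1)]])
           (auto simp: fun_eq_iff)
      have dL: "((\<lambda>x. (x, F 0)) has_derivative (\<lambda>w. (w, 0))) (at x)"
        by (auto intro!: derivative_eq_intros)
      have "(\<eta> has_derivative (\<lambda>w. (0 - w * F1 ?z) / F2 ?z)) (at x)"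
        using has_derivative_snd[OF has_derivative_compose[OF dL dG]] by (simp add: \<eta>_def)
      then show ?thesis
        by (rule has_derivative_imp_has_field_derivative) simp
    qed
  qed
qed

text \<open>For the graph of a function with derivative \<open>D\<close>, \<open>\<xi>\<close> is the abscissa as a function of arc length
  measured from \<open>0\<close>: the inverse of the integral of \<open>sqrt (1 + D\<^sup>2)\<close>. The range \<open>X\<close> is recorded
  because it describes the neighbourhood in which the reparametrized curve fills the graph.\<close>

lemma arclength_parameter:
  fixes D :: "real \<Rightarrow> real"
  assumes "a > 0" and cont: "\<And>x. \<bar>x\<bar> < a \<Longrightarrow> isCont D x"
  obtains e \<xi> X where "e > 0" "open X" "X \<subseteq> {-a<..<a}" "\<xi> ` {-e<..<e} = X" "\<xi> 0 = 0"
    and "\<And>t. \<bar>t\<bar> < e \<Longrightarrow> (\<xi> has_real_derivative 1 / sqrt (1 + (D (\<xi> t))\<^sup>2)) (at t)"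
proof -
  define r where "r = (\<lambda>x. sqrt (1 + (D x)\<^sup>2))"
  \<comment> \<open>Shrinking to a compact interval makes the arc length element integrable.\<close>
  define c where "c = a / 2"
  have c: "0 < c" "c < a" using \<open>a > 0\<close> by (auto simp: c_def)
  define S where "S = {-c<..<c}"
  have S: "open S" "0 \<in> S" using c by (auto simp: S_def)
  have pos: "r x > 0" for x by (simp add: r_def add_pos_nonneg)
  have contr: "continuous_on {-c..c} r"
    unfolding r_def
    by (intro continuous_intros continuous_at_imp_continuous_on ballI cont) (use c in auto)
  define \<sigma> where "\<sigma> = (\<lambda>x. integral {-c..x} r - integral {-c..0} r)"
  have d\<sigma>: "(\<sigma> has_real_derivative r x) (at x)" if "x \<in> S" for x
  proof -
    have "((\<lambda>x. integral {-c..x} r) has_real_derivative r x) (at x within {-c..c})"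
      using that by (intro integral_has_real_derivative contr) (auto simp: S_def)
    moreover have "at x within {-c..c} = at x"
      using that by (intro at_within_interior) (auto simp: S_def)
    ultimately show ?thesis unfolding \<sigma>_def by (auto intro!: derivative_eq_intros)
  qed
  have c\<sigma>: "continuous_on S \<sigma>"
    using d\<sigma> DERIV_isCont continuous_at_imp_continuous_on by blast
  have mono: "\<sigma> x < \<sigma> y" if "x < y" "x \<in> S" "y \<in> S" for x y
  proof (rule DERIV_pos_imp_increasing[OF \<open>x < y\<close>])
    fix t assume "x \<le> t" "t \<le> y"
    then have "t \<in> S" using that by (auto simp: S_def)
    then show "\<exists>d. (\<sigma> has_real_derivative d) (at t) \<and> 0 < d" using d\<sigma> pos by blast
  qed
  have inj: "inj_on \<sigma> S"
    by (rule inj_onI) (metis mono less_irrefl linorder_less_linear)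
  have "open (\<sigma> ` S)" by (rule invariance_of_domain[OF c\<sigma> \<open>open S\<close> inj])
  moreover have \<sigma>0: "\<sigma> 0 = 0" by (simp add: \<sigma>_def)
  then have "0 \<in> \<sigma> ` S" using S by (metis imageI)
  ultimately obtain e where e: "e > 0" "ball 0 e \<subseteq> \<sigma> ` S" using openE by blast
  define \<xi> where "\<xi> = inv_into S \<sigma>"
  have \<xi>: "\<xi> (\<sigma> x) = x" if "x \<in> S" for x using that inj by (simp add: \<xi>_def)
  have \<xi>': "\<xi> t \<in> S \<and> \<sigma> (\<xi> t) = t" if "\<bar>t\<bar> < e" for t
  proof -
    have "t \<in> \<sigma> ` S" using that e by (auto simp: subset_iff)
    then show ?thesis unfolding \<xi>_def by (simp add: inv_into_into f_inv_into_f)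
  qed
  show thesis
  proof (rule that[of e "S \<inter> \<sigma> -` {-e<..<e}" \<xi>])
    show "e > 0" by fact
    show "open (S \<inter> \<sigma> -` {-e<..<e})" by (intro continuous_open_preimage c\<sigma> S) auto
    show "S \<inter> \<sigma> -` {-e<..<e} \<subseteq> {-a<..<a}" using c by (auto simp: S_def)
    show "\<xi> ` {-e<..<e} = S \<inter> \<sigma> -` {-e<..<e}"
    proof (intro equalityI subsetI)
      fix x assume "x \<in> S \<inter> \<sigma> -` {-e<..<e}"
      then show "x \<in> \<xi> ` {-e<..<e}" by (intro image_eqI[of _ _ "\<sigma> x"]) (auto simp: \<xi>)
    qed (use \<xi>' in \<open>auto simp: abs_less_iff\<close>)
    show "\<xi> 0 = 0" using \<xi>[of 0] S \<sigma>0 by simp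
    show "(\<xi> has_real_derivative 1 / sqrt (1 + (D (\<xi> t))\<^sup>2)) (at t)" if "\<bar>t\<bar> < e" for t
    proof -
      have t: "\<xi> t \<in> S" "\<sigma> (\<xi> t) = t" using \<xi>'[OF that] by auto
      have "(\<xi> has_real_derivative inverse (r (\<xi> t))) (at (\<sigma> (\<xi> t)))"
        unfolding has_field_derivative_def
        by (rule has_derivative_inverse_strong[OF \<open>open S\<close> t(1) c\<sigma> \<xi>
              d\<sigma>[OF t(1), unfolded has_field_derivative_def]])
           (use pos[of "\<xi> t"] in \<open>auto simp: fun_eq_iff\<close>)
      then show ?thesis by (simp add: t r_def inverse_eq_divide)
    qed
  qed
qed

section \<open>Normal curvature as a quadratic form of the Hessian\<close>

lemma grad_eqI: "GDERIV u x :> D \<Longrightarrow> grad u x = D"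
  for u :: "'a::euclidean_space \<Rightarrow> real"
proof -
  assume D: "GDERIV u x :> D"
  have "D' = D" if "GDERIV u x :> D'" for D'
  proof -
    have "(\<lambda>h. h \<bullet> D') = (\<lambda>h. h \<bullet> D)"
      using D that unfolding gderiv_def by (rule has_derivative_unique[rotated])
    then show ?thesis by (metis vector_eq_ldot)
  qed
  with D show ?thesis unfolding grad_def by (rule the_equality)
qed

lemma has_vector_derivative_gradient_along:
  fixes u :: "'a::euclidean_space \<Rightarrow> real"
  assumes "(\<gamma> has_vector_derivative w) (at t)" "GDERIV u (\<gamma> t) :> D"
  shows "((\<lambda>t. u (\<gamma> t)) has_real_derivative w \<bullet> D) (at t)"
proof -
  have "((\<lambda>t. u (\<gamma> t)) has_derivative (\<lambda>s. (s *\<^sub>R w) \<bullet> D)) (at t)"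
    using has_derivative_compose[of \<gamma> _ t UNIV u]
      assms[unfolded has_vector_derivative_def gderiv_def] by blast
  then show ?thesis
    by (rule has_derivative_imp_has_field_derivative) simp
qed

lemma has_vector_derivative_compose_along:
  assumes "(\<gamma> has_vector_derivative w) (at t within S)" "(g has_derivative g') (at (\<gamma> t))"
  shows "((\<lambda>t. g (\<gamma> t)) has_vector_derivative g' w) (at t within S)"
proof -
  have "((\<lambda>t. g (\<gamma> t)) has_derivative (\<lambda>s. g' (s *\<^sub>R w))) (at t within S)"
    using has_derivative_compose assms unfolding has_vector_derivative_def by blast
  then show ?thesis
    unfolding has_vector_derivative_def
    using linear_scale[OF has_derivative_linear[OF assms(2)]] by simp
qed

text \<open>In the plane coordinates \<open>(x, y) \<mapsto> q + x v + y N\<close> the function \<open>u\<close> has partial derivatives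
  \<open>g \<bullet> v\<close> and \<open>g \<bullet> N\<close>; they are \<open>0\<close> and \<open>norm (g q) > 0\<close> at the origin. So the section is a graph
  with horizontal tangent at \<open>q\<close>, and the slope of this graph is itself differentiable because it
  is a quotient of components of \<open>g\<close> along the curve. Parametrized by arc length, the curve
  therefore has a second derivative at \<open>q\<close>; the horizontal tangent makes it normal.\<close>

lemma normal_section_exists:
  fixes u :: "'a::euclidean_space \<Rightarrow> real"
  assumes "open \<Omega>" "q \<in> \<Omega>"
    and g: "\<And>x. x \<in> \<Omega> \<Longrightarrow> GDERIV u x :> g x"
    and h: "\<And>x. x \<in> \<Omega> \<Longrightarrow> (g has_derivative h x) (at x)"
    and "g q \<noteq> 0" and v: "norm v = 1" "v \<bullet> g q = 0"
  shows "\<exists>\<gamma> \<gamma>' k. normal_section \<Omega> u q v \<gamma> \<gamma>' \<and>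
      (\<gamma>' has_vector_derivative k *\<^sub>R unit_normal u q) (at 0)"
proof -
  define N where "N = unit_normal u q"
  have N: "N = g q /\<^sub>R norm (g q)"
    using grad_eqI[OF g[OF \<open>q \<in> \<Omega>\<close>]] by (simp add: N_def unit_normal_def)
  have NN: "N \<bullet> N = 1" "v \<bullet> N = 0" "N \<bullet> v = 0" "v \<bullet> v = 1"
    using v \<open>g q \<noteq> 0\<close>
    by (simp_all add: N inner_commute power2_norm_eq_inner[symmetric] power2_eq_square norm_eq_1)
  define P where "P = (\<lambda>z. q + fst z *\<^sub>R v + snd z *\<^sub>R N)"
  have dP: "(P has_derivative (\<lambda>w. fst w *\<^sub>R v + snd w *\<^sub>R N)) (at z)" for z
    unfolding P_def by (auto intro!: derivative_eq_intros)
  have P0: "P 0 = q" by (simp add: P_def)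
  have contP: "isCont P z" for z using dP has_derivative_continuous by blast
  define W where "W = P -` \<Omega>"
  have "open W" unfolding W_def using contP \<open>open \<Omega>\<close> by (intro open_vimage) (auto simp: continuous_on_eq_continuous_at)
  have "0 \<in> W" using \<open>q \<in> \<Omega>\<close> by (simp add: W_def P0)
  define F where "F = (\<lambda>z. u (P z))"
  define F1 where "F1 = (\<lambda>z. g (P z) \<bullet> v)"
  define F2 where "F2 = (\<lambda>z. g (P z) \<bullet> N)"
  have dF: "(F has_derivative (\<lambda>w. fst w * F1 z + snd w * F2 z)) (at z)" if "z \<in> W" for z
  proof -
    have "(F has_derivative (\<lambda>w. (fst w *\<^sub>R v + snd w *\<^sub>R N) \<bullet> g (P z))) (at z)"
      unfolding F_def
      by (rule has_derivative_compose[OF dP]) (use g that in \<open>auto simp: W_def gderiv_def\<close>)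
    then show ?thesis
      by (simp add: inner_add_right inner_commute[of _ "g (P z)"] F1_def F2_def)
  qed
  have "continuous_on W (\<lambda>z. g (P z))"
    by (intro continuous_at_imp_continuous_on ballI
        isCont_o2[OF contP has_derivative_continuous[OF h]]) (simp add: W_def)
  then have cF2: "continuous_on W F2" unfolding F2_def by (intro continuous_intros)
  have "F2 0 > 0" using \<open>g q \<noteq> 0\<close>
    by (simp add: F2_def P0 N power2_norm_eq_inner[symmetric])
  obtain a b \<eta> where ab: "a > 0" "b > 0" and box: "{-a<..<a} \<times> {-b<..<b} \<subseteq> W"
    and pos: "\<And>z. z \<in> {-a<..<a} \<times> {-b<..<b} \<Longrightarrow> F2 z > 0"
    and \<eta>b: "\<And>x. \<bar>x\<bar> < a \<Longrightarrow> \<bar>\<eta> x\<bar> < b"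
    and \<eta>: "\<And>x y. \<bar>x\<bar> < a \<Longrightarrow> \<bar>y\<bar> < b \<Longrightarrow> F (x, y) = F 0 \<longleftrightarrow> y = \<eta> x"
    and d\<eta>: "\<And>x. \<bar>x\<bar> < a \<Longrightarrow> (\<eta> has_real_derivative - F1 (x, \<eta> x) / F2 (x, \<eta> x)) (at x)"
  proof (rule implicit_graph[OF \<open>open W\<close> \<open>0 \<in> W\<close> dF cF2 \<open>F2 0 > 0\<close>], goal_cases)
    case (2 a b \<eta>)
    from 2(2-) show ?case by (rule 2(1))
  qed
  define D where "D = (\<lambda>x. - F1 (x, \<eta> x) / F2 (x, \<eta> x))"
  define c where "c = (\<lambda>x. P (x, \<eta> x))"
  have inbox: "(x, \<eta> x) \<in> {-a<..<a} \<times> {-b<..<b}" if "\<bar>x\<bar> < a" for x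
    using that \<eta>b[OF that] by auto
  have c\<Omega>: "c x \<in> \<Omega>" if "\<bar>x\<bar> < a" for x
    using inbox[OF that] box unfolding c_def W_def by blast
  have \<eta>0: "\<eta> 0 = 0" using \<eta>[of 0 0] ab by (simp add: zero_prod_def)
  then have c0: "c 0 = q" using P0 by (simp add: c_def zero_prod_def)
  then have D0: "D 0 = 0" using v by (simp add: D_def F1_def c_def inner_commute)
  have dc: "(c has_vector_derivative v + D x *\<^sub>R N) (at x)" if "\<bar>x\<bar> < a" for x
    unfolding c_def P_def
    by (rule derivative_eq_intros d\<eta>[OF that, folded D_def] refl has_vector_derivative_scaleR | simp)+
       (simp add: D_def)
  have "\<exists>d. (D has_real_derivative d) (at x)" if "\<bar>x\<bar> < a" for x
  proof -
    have "((\<lambda>x. g (c x)) has_vector_derivative h (c x) (v + D x *\<^sub>R N)) (at x)"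
      by (rule has_vector_derivative_compose_along[OF dc[OF that] h[OF c\<Omega>[OF that]]])
    then have dg: "((\<lambda>x. g (c x) \<bullet> w) has_real_derivative h (c x) (v + D x *\<^sub>R N) \<bullet> w) (at x)" for w
      by (auto simp: has_real_derivative_iff_has_vector_derivative
          intro: bounded_linear.has_vector_derivative[OF bounded_linear_inner_left])
    have "g (c x) \<bullet> N \<noteq> 0" using pos[OF inbox[OF that]] by (simp add: F2_def c_def)
    moreover have "D = (\<lambda>x. - (g (c x) \<bullet> v) / (g (c x) \<bullet> N))"
      by (simp add: D_def F1_def F2_def c_def)
    ultimately show ?thesis using DERIV_divide[OF DERIV_minus[OF dg[of v]] dg[of N]] by blast
  qed
  then obtain d where d: "\<And>x. \<bar>x\<bar> < a \<Longrightarrow> (D has_real_derivative d x) (at x)" by metis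
  obtain e \<xi> X where e: "e > 0" and X: "open X" "X \<subseteq> {-a<..<a}" and im: "\<xi> ` {-e<..<e} = X"
    and \<xi>0: "\<xi> 0 = 0"
    and d\<xi>: "\<And>t. \<bar>t\<bar> < e \<Longrightarrow> (\<xi> has_real_derivative 1 / sqrt (1 + (D (\<xi> t))\<^sup>2)) (at t)"
  proof (rule arclength_parameter[OF \<open>a > 0\<close> DERIV_isCont[OF d]], goal_cases)
    case (2 e X \<xi>)
    from 2(2-) show ?case by (rule 2(1))
  qed
  have Xa: "\<bar>x\<bar> < a" if "x \<in> X" for x using subsetD[OF X(2) that] by auto
  have \<xi>a: "\<bar>\<xi> t\<bar> < a" if "\<bar>t\<bar> < e" for t
    using that im by (intro Xa) (auto simp: abs_less_iff)
  define \<tau> where "\<tau> = (\<lambda>x. (1 / sqrt (1 + (D x)\<^sup>2)) *\<^sub>R (v + D x *\<^sub>R N))"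
  define \<gamma> where "\<gamma> = (\<lambda>t. c (\<xi> t))"
  define \<gamma>' where "\<gamma>' = (\<lambda>t. \<tau> (\<xi> t))"
  have d\<gamma>: "(\<gamma> has_vector_derivative \<gamma>' t) (at t)" if "\<bar>t\<bar> < e" for t
    using vector_diff_chain_at[OF d\<xi>[OF that, unfolded has_real_derivative_iff_has_vector_derivative]
        dc[OF \<xi>a[OF that]]]
    by (simp add: \<gamma>_def \<gamma>'_def \<tau>_def o_def)
  have norm1: "norm (\<tau> x) = 1" for x
  proof -
    have "(norm (v + D x *\<^sub>R N))\<^sup>2 = 1 + (D x)\<^sup>2"
      unfolding power2_norm_eq_inner
      by (simp add: inner_add_left inner_add_right NN power2_eq_square)
    then have "norm (v + D x *\<^sub>R N) = sqrt (1 + (D x)\<^sup>2)"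
      by (metis norm_ge_zero real_sqrt_unique)
    moreover have "sqrt (1 + (D x)\<^sup>2) > 0" by (simp add: add_pos_nonneg)
    ultimately show ?thesis by (simp add: \<tau>_def)
  qed
  \<comment> \<open>The factor normalizing the speed is stationary at \<open>0\<close> because the slope vanishes there.\<close>
  have "(\<tau> has_vector_derivative d 0 *\<^sub>R N) (at 0)"
  proof -
    have "((\<lambda>x. 1 / sqrt (1 + (D x)\<^sup>2)) has_real_derivative 0) (at 0)"
      using d[of 0] \<open>a > 0\<close> D0 by (auto intro!: derivative_eq_intros)
    moreover have "((\<lambda>x. v + D x *\<^sub>R N) has_vector_derivative d 0 *\<^sub>R N) (at 0)"
      using d[of 0] \<open>a > 0\<close> by (auto intro!: derivative_eq_intros)
    ultimately show ?thesis
      unfolding \<tau>_def by (rule has_vector_derivative_scaleR[THEN has_vector_derivative_eq_rhs]) (simp add: D0)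
  qed
  then have d\<gamma>': "(\<gamma>' has_vector_derivative d 0 *\<^sub>R N) (at 0)"
    using vector_diff_chain_at[of \<xi> 1 0 \<tau> "d 0 *\<^sub>R N"] d\<xi>[of 0] e D0
    by (simp add: \<gamma>'_def o_def \<xi>0 has_real_derivative_iff_has_vector_derivative)
  define U where "U = {w. (w - q) \<bullet> v \<in> X \<and> \<bar>(w - q) \<bullet> N\<bar> < b}"
  have "open U"
  proof -
    have "U = (\<lambda>w. (w - q) \<bullet> v) -` X \<inter> (\<lambda>w. \<bar>(w - q) \<bullet> N\<bar>) -` {..<b}" by (auto simp: U_def)
    also have "open \<dots>" using X(1) by (intro open_Int open_vimage continuous_intros) auto
    finally show ?thesis .
  qed
  have comp: "(P (x, y) - q) \<bullet> v = x" "(P (x, y) - q) \<bullet> N = y" for x y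
    by (simp_all add: P_def inner_add_left NN)
  have "c ` X = level_set \<Omega> u q \<inter> (\<lambda>w. q + w) ` span {v, N} \<inter> U"
  proof (intro equalityI subsetI)
    fix w assume "w \<in> c ` X"
    then obtain x where x: "x \<in> X" "w = c x" by blast
    then have xa: "\<bar>x\<bar> < a" using Xa by blast
    have "u w = u q" using \<eta>[OF xa \<eta>b[OF xa]] x by (simp add: F_def c_def P0)
    moreover have "x *\<^sub>R v + \<eta> x *\<^sub>R N \<in> span {v, N}"
      by (intro span_add span_scale span_base) auto
    then have "w \<in> (\<lambda>w. q + w) ` span {v, N}"
      unfolding x(2) c_def P_def by (auto simp: add.assoc)
    ultimately show "w \<in> level_set \<Omega> u q \<inter> (\<lambda>w. q + w) ` span {v, N} \<inter> U"
      using c\<Omega>[OF xa] x \<eta>b[OF xa] by (auto simp: level_set_def U_def c_def comp)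
  next
    fix w assume w: "w \<in> level_set \<Omega> u q \<inter> (\<lambda>w. q + w) ` span {v, N} \<inter> U"
    then obtain s where s: "w = q + s" "s \<in> span {v, N}" by blast
    then obtain x y where xy: "s - x *\<^sub>R v - y *\<^sub>R N = 0" unfolding span_breakdown_eq by auto
    then have "s = x *\<^sub>R v + y *\<^sub>R N" by (simp add: algebra_simps)
    then have wP: "w = P (x, y)" using s by (simp add: P_def)
    then have xX: "x \<in> X" and y: "\<bar>y\<bar> < b" using w by (auto simp: U_def comp)
    then have "\<bar>x\<bar> < a" using Xa by blast
    moreover have "F (x, y) = F 0" using w wP by (simp add: F_def P0 level_set_def)
    ultimately have "y = \<eta> x" using \<eta> y by blast
    with wP xX show "w \<in> c ` X" by (auto simp: c_def)
  qed
  moreover have "\<gamma> ` {-e<..<e} = c ` X" unfolding im[symmetric] by (simp add: \<gamma>_def image_image)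
  ultimately have im\<gamma>: "\<gamma> ` {-e<..<e} = level_set \<Omega> u q \<inter> (\<lambda>w. q + w) ` span {v, N} \<inter> U"
    by simp
  have "\<gamma> 0 = q" by (simp add: \<gamma>_def \<xi>0 c0)
  moreover have "\<gamma>' 0 = v" by (simp add: \<gamma>'_def \<xi>0 \<tau>_def D0)
  moreover have "(\<gamma> has_vector_derivative \<gamma>' t) (at t) \<and> norm (\<gamma>' t) = 1" if "t \<in> {-e<..<e}" for t
    using d\<gamma>[of t] norm1[of "\<xi> t"] that by (auto simp: \<gamma>'_def)
  ultimately have "normal_section \<Omega> u q v \<gamma> \<gamma>'"
    unfolding normal_section_def N_def[symmetric] using e \<open>open U\<close> im\<gamma> by blast
  with d\<gamma>' show ?thesis unfolding N_def by blast
qed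

text \<open>The velocity of any normal section is orthogonal to the gradient, since \<open>u\<close> is constant along
  it. Differentiating this orthogonality at \<open>0\<close> determines \<open>k\<close>, whichever section was used.\<close>

lemma normal_section_curvature:
  fixes u :: "'a::euclidean_space \<Rightarrow> real"
  assumes g: "\<And>x. x \<in> \<Omega> \<Longrightarrow> GDERIV u x :> g x"
    and h: "\<And>x. x \<in> \<Omega> \<Longrightarrow> (g has_derivative h x) (at x)"
    and "g q \<noteq> 0"
    and ns: "normal_section \<Omega> u q v \<gamma> \<gamma>'"
    and k: "(\<gamma>' has_vector_derivative k *\<^sub>R unit_normal u q) (at 0)"
  shows "k = - (h q v \<bullet> v) / norm (g q)"
proof -
  obtain e U where e: "e > 0"
    and im: "\<gamma> ` {-e<..<e} = level_set \<Omega> u q \<inter> (\<lambda>w. q + w) ` span {v, unit_normal u q} \<inter> U"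
    and d: "\<And>t. t \<in> {-e<..<e} \<Longrightarrow> (\<gamma> has_vector_derivative \<gamma>' t) (at t)"
    and \<gamma>0: "\<gamma> 0 = q" "\<gamma>' 0 = v"
    using ns unfolding normal_section_def by blast
  have lev: "\<gamma> t \<in> \<Omega>" "u (\<gamma> t) = u q" if "t \<in> {-e<..<e}" for t
    using im that by (auto simp: level_set_def)
  have q: "q \<in> \<Omega>" using lev[of 0] e \<gamma>0 by simp
  have N: "unit_normal u q = g q /\<^sub>R norm (g q)"
    using grad_eqI[OF g[OF q]] by (simp add: unit_normal_def)
  have orth: "\<gamma>' t \<bullet> g (\<gamma> t) = 0" if t: "t \<in> {-e<..<e}" for t
  proof -
    have "((\<lambda>t. u (\<gamma> t)) has_real_derivative \<gamma>' t \<bullet> g (\<gamma> t)) (at t)"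
      by (intro has_vector_derivative_gradient_along d g lev t)
    moreover have "((\<lambda>t. u (\<gamma> t)) has_real_derivative 0) (at t)"
      by (rule has_field_derivative_transform_within_open[of "\<lambda>_. u q" 0 t "{-e<..<e}"])
         (use t lev in auto)
    ultimately show ?thesis by (rule DERIV_unique)
  qed
  have dg: "((\<lambda>t. g (\<gamma> t)) has_vector_derivative h q v) (at 0)"
    using has_vector_derivative_compose_along[OF d[of 0], of g "h q"] h[OF q] e \<gamma>0 by simp
  have "((\<lambda>t. \<gamma>' t \<bullet> g (\<gamma> t)) has_vector_derivative
      \<gamma>' 0 \<bullet> h q v + (k *\<^sub>R unit_normal u q) \<bullet> g (\<gamma> 0)) (at 0)"
    by (rule bounded_bilinear.has_vector_derivative[OF bounded_bilinear_inner k dg])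
  moreover have "((\<lambda>t. \<gamma>' t \<bullet> g (\<gamma> t)) has_vector_derivative 0) (at 0)"
    by (rule has_vector_derivative_transform_within_open[of "\<lambda>_. 0" 0 0 "{-e<..<e}"])
       (use e orth in auto)
  ultimately have "\<gamma>' 0 \<bullet> h q v + (k *\<^sub>R unit_normal u q) \<bullet> g (\<gamma> 0) = 0"
    by (rule vector_derivative_unique_at)
  then have "v \<bullet> h q v + k * norm (g q) = 0"
    using \<open>g q \<noteq> 0\<close>
    by (simp add: \<gamma>0 N power2_norm_eq_inner[symmetric] power2_eq_square field_simps)
  then show ?thesis using \<open>g q \<noteq> 0\<close> by (simp add: field_simps inner_commute)
qed

lemma normal_curvature_eq:
  fixes u :: "'a::euclidean_space \<Rightarrow> real"
  assumes "open \<Omega>" "q \<in> \<Omega>"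
    and "\<And>x. x \<in> \<Omega> \<Longrightarrow> GDERIV u x :> g x"
    and "\<And>x. x \<in> \<Omega> \<Longrightarrow> (g has_derivative h x) (at x)"
    and "g q \<noteq> 0" and "norm v = 1" "v \<bullet> g q = 0"
  shows "normal_curvature \<Omega> u q v = - (h q v \<bullet> v) / norm (g q)"
  unfolding normal_curvature_def
  using normal_section_exists[OF assms] normal_section_curvature[OF assms(3,4,5)]
  by (intro the_equality) blast+

section \<open>Orthonormal bases and traces\<close>

lemma onb:
  assumes "subspace V"
  shows "onb V \<subseteq> V" "pairwise orthogonal (onb V)" "\<And>b. b \<in> onb V \<Longrightarrow> norm b = 1"
    and "span (onb V) = V" "finite (onb V)" "card (onb V) = dim V"
proof -
  have "\<exists>B. B \<subseteq> V \<and> pairwise orthogonal B \<and> (\<forall>b\<in>B. norm b = 1) \<and> span B = V"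
    using orthonormal_basis_subspace[OF assms] by metis
  from someI_ex[OF this, folded onb_def]
  show *: "onb V \<subseteq> V" "pairwise orthogonal (onb V)" "\<And>b. b \<in> onb V \<Longrightarrow> norm b = 1"
    "span (onb V) = V" by auto
  have "independent (onb V)"
    using *(3) by (intro pairwise_orthogonal_independent[OF *(2)]) force
  then show "finite (onb V)" "card (onb V) = dim V"
    using *(4) independent_imp_finite dim_span dim_eq_card_independent by metis+
qed

text \<open>Expanding \<open>b\<close> in \<open>C\<close> inside \<open>A b \<bullet> b\<close> and then summing over \<open>b\<close> first reassembles \<open>A c \<bullet> c\<close>.\<close>

lemma trace_orthonormal_basis:
  fixes A :: "'a::euclidean_space \<Rightarrow> 'a"
  assumes "linear A" "finite C" "pairwise orthogonal C" "\<And>c. c \<in> C \<Longrightarrow> norm c = 1" "span C = UNIV"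
  shows "(\<Sum>b\<in>Basis. A b \<bullet> b) = (\<Sum>c\<in>C. A c \<bullet> c)"
proof -
  have "A b \<bullet> b = (\<Sum>c\<in>C. (b \<bullet> c) * (A c \<bullet> b))" for b
  proof -
    have "A b = A (\<Sum>c\<in>C. (b \<bullet> c) *\<^sub>R c)"
      using orthonormal_basis_expand[OF assms(3,4) _ assms(2), of b] assms(5) by simp
    then have "A b = (\<Sum>c\<in>C. (b \<bullet> c) *\<^sub>R A c)"
      by (simp add: linear_sum[OF assms(1)] linear_scale[OF assms(1)])
    then show ?thesis by (simp add: inner_sum_left)
  qed
  then have "(\<Sum>b\<in>Basis. A b \<bullet> b) = (\<Sum>b\<in>Basis. \<Sum>c\<in>C. (b \<bullet> c) * (A c \<bullet> b))" by simp
  also have "\<dots> = (\<Sum>c\<in>C. \<Sum>b\<in>Basis. (A c \<bullet> b) * (c \<bullet> b))"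
    by (subst sum.swap) (simp add: inner_commute mult.commute)
  also have "\<dots> = (\<Sum>c\<in>C. A c \<bullet> c)" by (simp add: euclidean_inner[symmetric])
  finally show ?thesis .
qed

section \<open>Averaging a quadratic form over a sphere\<close>

interpretation lborel_prod: product_sigma_finite "\<lambda>_::'b. lborel :: real measure" ..

text \<open>Two kinds of symmetries of Lebesgue measure in coordinates are enough to average a quadratic form:
  sign changes kill the mixed terms, and transpositions equate the pure squares. Both are of the
  form below.\<close>

lemma distr_PiM_lborel_signed_involution:
  fixes B :: "'b set" and s :: "'b \<Rightarrow> real" and \<pi> :: "'b \<Rightarrow> 'b"
  assumes "finite B" and \<pi>: "\<And>b. b \<in> B \<Longrightarrow> \<pi> b \<in> B" "\<And>b. b \<in> B \<Longrightarrow> \<pi> (\<pi> b) = b"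
    and s: "\<And>b. b \<in> B \<Longrightarrow> s b = 1 \<or> s b = -1"
  defines "M \<equiv> \<Pi>\<^sub>M b\<in>B. (lborel :: real measure)"
  shows "(\<lambda>x. \<lambda>b\<in>B. s b * x (\<pi> b)) \<in> measurable M M"
    and "distr M M (\<lambda>x. \<lambda>b\<in>B. s b * x (\<pi> b)) = M"
proof -
  let ?T = "\<lambda>x. \<lambda>b\<in>B. s b * x (\<pi> b)"
  show T: "?T \<in> measurable M M"
    unfolding M_def using \<pi> by (intro measurable_restrict) measurable
  show "distr M M ?T = M"
    unfolding M_def
  proof (rule lborel_prod.PiM_eqI)
    fix A :: "'b \<Rightarrow> real set" assume A: "\<And>b. b \<in> B \<Longrightarrow> A b \<in> sets lborel"
    let ?A = "\<lambda>b. (\<lambda>x. s (\<pi> b) * x) -` A (\<pi> b)"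
    have A': "?A b \<in> sets lborel" "emeasure lborel (?A b) = emeasure lborel (A (\<pi> b))" if "b \<in> B" for b
    proof -
      have Ab: "A (\<pi> b) \<in> sets borel" using A \<pi> that by simp
      then have "(\<lambda>x. s (\<pi> b) * x) -` A (\<pi> b) \<inter> space borel \<in> sets borel"
        by (rule measurable_sets[rotated]) simp
      then show "?A b \<in> sets lborel" by simp
      have "emeasure lborel (uminus -` A (\<pi> b)) = emeasure lborel (A (\<pi> b))"
        using Ab emeasure_distr[of uminus lborel borel "A (\<pi> b)"] by (simp add: lborel_distr_uminus)
      moreover have "(*) 1 = (id :: real \<Rightarrow> real)" "(*) (-1) = (uminus :: real \<Rightarrow> real)" by auto
      ultimately show "emeasure lborel (?A b) = emeasure lborel (A (\<pi> b))"
        using s[OF \<pi>(1)[OF that]] by auto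
    qed
    have "?T -` Pi\<^sub>E B A \<inter> space (Pi\<^sub>M B (\<lambda>_. lborel)) = Pi\<^sub>E B ?A"
    proof (intro equalityI subsetI)
      fix x assume "x \<in> ?T -` Pi\<^sub>E B A \<inter> space (Pi\<^sub>M B (\<lambda>_. lborel))"
      then have 1: "\<And>b. b \<in> B \<Longrightarrow> s b * x (\<pi> b) \<in> A b" and 2: "x \<in> extensional B"
        by (auto simp: PiE_iff space_PiM)
      have "s (\<pi> b) * x b \<in> A (\<pi> b)" if "b \<in> B" for b
        using 1[OF \<pi>(1)[OF that]] \<pi>(2)[OF that] by simp
      with 2 show "x \<in> Pi\<^sub>E B ?A" by (auto simp: PiE_iff)
    next
      fix x assume x: "x \<in> Pi\<^sub>E B ?A"
      have "s b * x (\<pi> b) \<in> A b" if "b \<in> B" for b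
        using PiE_mem[OF x \<pi>(1)[OF that]] \<pi>(2)[OF that] by simp
      then show "x \<in> ?T -` Pi\<^sub>E B A \<inter> space (Pi\<^sub>M B (\<lambda>_. lborel))"
        using x by (auto simp: PiE_iff space_PiM)
    qed
    then have "emeasure (distr (Pi\<^sub>M B (\<lambda>_. lborel)) (Pi\<^sub>M B (\<lambda>_. lborel)) ?T) (Pi\<^sub>E B A) =
        emeasure (Pi\<^sub>M B (\<lambda>_. lborel)) (Pi\<^sub>E B ?A)"
      using A \<open>finite B\<close> T[unfolded M_def]
      by (subst emeasure_distr) (auto intro!: sets_PiM_I_finite)
    also have "\<dots> = (\<Prod>b\<in>B. emeasure lborel (?A b))"
      using A' \<open>finite B\<close> by (intro lborel_prod.emeasure_PiM) auto
    also have "\<dots> = (\<Prod>b\<in>B. emeasure lborel (A (\<pi> b)))" using A' by (intro prod.cong) auto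
    also have "\<dots> = (\<Prod>b\<in>B. emeasure lborel (A b))"
      by (rule prod.reindex_bij_witness[of _ \<pi> \<pi>]) (use \<pi> in auto)
    finally show "emeasure (distr (Pi\<^sub>M B (\<lambda>_. lborel)) (Pi\<^sub>M B (\<lambda>_. lborel)) ?T) (Pi\<^sub>E B A) =
        (\<Prod>b\<in>B. emeasure lborel (A b))" .
  qed (use \<open>finite B\<close> in auto)
qed

text \<open>Coordinates of the vectors in the unit ball whose radial projection lies on the sphere: the
  origin is removed, because \<open>sgn 0 = 0\<close>.\<close>

definition coord_ball :: "'b set \<Rightarrow> ('b \<Rightarrow> real) set" where
  "coord_ball B = {x \<in> extensional B. 0 < (\<Sum>b\<in>B. (x b)\<^sup>2) \<and> (\<Sum>b\<in>B. (x b)\<^sup>2) \<le> 1}"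

lemma coord_ball_sets [measurable]:
  "coord_ball B \<in> sets (\<Pi>\<^sub>M b\<in>B. (lborel :: real measure))"
proof -
  have "coord_ball B = {x \<in> space (\<Pi>\<^sub>M b\<in>B. (lborel :: real measure)).
      0 < (\<Sum>b\<in>B. (x b)\<^sup>2) \<and> (\<Sum>b\<in>B. (x b)\<^sup>2) \<le> 1}"
    by (auto simp: coord_ball_def space_PiM PiE_def)
  also have "\<dots> \<in> sets (\<Pi>\<^sub>M b\<in>B. (lborel :: real measure))" by measurable
  finally show ?thesis .
qed

text \<open>The ball lies between a cube of side \<open>2\<close> around the origin and a small cube in the positive
  orthant, which keeps away from the origin.\<close>

lemma coord_ball_measure:
  assumes "finite B" "B \<noteq> {}"
  defines "M \<equiv> \<Pi>\<^sub>M b\<in>B. (lborel :: real measure)"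
  shows "emeasure M (coord_ball B) < \<infinity>" "measure M (coord_ball B) > 0"
proof -
  have "coord_ball B \<subseteq> Pi\<^sub>E B (\<lambda>_. {-1..1})"
  proof
    fix x assume x: "x \<in> coord_ball B"
    have "\<bar>x b\<bar> \<le> 1" if "b \<in> B" for b
    proof -
      have "(x b)\<^sup>2 \<le> (\<Sum>b\<in>B. (x b)\<^sup>2)" using that assms by (intro member_le_sum) auto
      also have "\<dots> \<le> 1" using x by (simp add: coord_ball_def)
      finally show ?thesis by (simp add: abs_square_le_1)
    qed
    then show "x \<in> Pi\<^sub>E B (\<lambda>_. {-1..1})" using x by (force simp: coord_ball_def PiE_iff abs_le_iff)
  qed
  then have "emeasure M (coord_ball B) \<le> emeasure M (Pi\<^sub>E B (\<lambda>_. {-1..1}))"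
    unfolding M_def using assms(1) by (intro emeasure_mono sets_PiM_I_finite) auto
  also have "\<dots> = (\<Prod>b\<in>B. emeasure lborel {-1..1::real})"
    unfolding M_def using assms(1) by (intro lborel_prod.emeasure_PiM) auto
  also have "\<dots> < \<infinity>" by (simp add: power_less_top_ennreal)
  finally show fin: "emeasure M (coord_ball B) < \<infinity>" .
  define n where "n = real (card B)"
  have n: "n \<ge> 1" using assms(1,2) by (simp add: n_def Suc_leI card_gt_0_iff)
  have "Pi\<^sub>E B (\<lambda>_. {1/(2*n)..1/n}) \<subseteq> coord_ball B"
  proof
    fix x assume x: "x \<in> Pi\<^sub>E B (\<lambda>_. {1/(2*n)..1/n})"
    have pos: "x b > 0" if "b \<in> B" for b
    proof -
      have "1/(2*n) \<le> x b" using PiE_mem[OF x that] by simp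
      moreover have "1/(2*n) > 0" using n by simp
      ultimately show ?thesis by linarith
    qed
    have "(\<Sum>b\<in>B. (x b)\<^sup>2) \<le> (\<Sum>b\<in>B. (1/n)\<^sup>2)"
      using pos PiE_mem[OF x] by (intro sum_mono power_mono) (auto intro: less_imp_le)
    also have "\<dots> = 1 / n" using n by (simp add: n_def[symmetric] power2_eq_square)
    also have "\<dots> \<le> 1" using n by simp
    finally have "(\<Sum>b\<in>B. (x b)\<^sup>2) \<le> 1" .
    moreover have "0 < (\<Sum>b\<in>B. (x b)\<^sup>2)" using pos assms(1,2) by (intro sum_pos) force+
    ultimately show "x \<in> coord_ball B" using x by (auto simp: coord_ball_def PiE_iff)
  qed
  then have "emeasure M (Pi\<^sub>E B (\<lambda>_. {1/(2*n)..1/n})) \<le> emeasure M (coord_ball B)"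
    unfolding M_def by (intro emeasure_mono coord_ball_sets)
  moreover have "emeasure M (Pi\<^sub>E B (\<lambda>_. {1/(2*n)..1/n})) = (\<Prod>b\<in>B. emeasure lborel {1/(2*n)..1/n})"
    unfolding M_def using assms(1) by (intro lborel_prod.emeasure_PiM) auto
  moreover have "1/(2*n) \<le> 1/n" "1/n - 1/(2*n) > 0" using n by (simp_all add: field_simps)
  then have "(\<Prod>b\<in>B. emeasure lborel {1/(2*n)..1/n}) > 0"
    by (simp only: emeasure_lborel_Icc prod_constant ennreal_power less_imp_le)
       (simp add: ennreal_less_zero_iff)
  ultimately have "emeasure M (coord_ball B) > 0" by order
  then show "measure M (coord_ball B) > 0"
    using fin by (simp add: measure_def enn2real_positive_iff)
qed

text \<open>For \<open>a \<noteq> b\<close>, reversing the sign of the coordinate \<open>a\<close> reverses the sign of the integrand.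
  For \<open>a = b\<close>, exchanging coordinates shows that the integral does not depend on \<open>a\<close>, and the
  integrands for all \<open>a\<close> add up to the indicator of the ball.\<close>

lemma coord_ball_quadratic_integral:
  fixes B :: "'b set"
  assumes "finite B" "B \<noteq> {}"
  defines "M \<equiv> \<Pi>\<^sub>M b\<in>B. (lborel :: real measure)"
  defines "G \<equiv> \<lambda>a b x. indicator (coord_ball B) x * (x a * x b / (\<Sum>c\<in>B. (x c)\<^sup>2)) :: real"
  assumes a: "a \<in> B" and b: "b \<in> B"
  shows "integrable M (G a b)"
    and "integral\<^sup>L M (G a b) = (if a = b then measure M (coord_ball B) / card B else 0)"
proof -
  have meas: "G a b \<in> borel_measurable M" if "a \<in> B" "b \<in> B" for a b
    unfolding G_def M_def using that by measurable
  have fin: "emeasure M (coord_ball B) < \<infinity>"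
    using coord_ball_measure[OF assms(1,2)] by (simp add: M_def)
  have intI: "integrable M (indicator (coord_ball B) :: _ \<Rightarrow> real)"
    using fin unfolding M_def by (intro integrable_real_indicator coord_ball_sets)
  have int: "integrable M (G a b)" if "a \<in> B" "b \<in> B" for a b
  proof (rule Bochner_Integration.integrable_bound[OF intI meas[OF that]], rule AE_I2)
    fix x :: "'b \<Rightarrow> real"
    define S where "S = (\<Sum>c\<in>B. (x c)\<^sup>2)"
    have le: "\<bar>x c\<bar> \<le> sqrt S" if "c \<in> B" for c
    proof -
      have "(x c)\<^sup>2 \<le> S" unfolding S_def using that assms(1) by (intro member_le_sum) auto
      then show ?thesis by (metis real_sqrt_abs real_sqrt_le_mono)
    qed
    have "S \<ge> 0" unfolding S_def by (simp add: sum_nonneg)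
    have "\<bar>x a * x b\<bar> \<le> sqrt S * sqrt S"
      unfolding abs_mult using le that by (intro mult_mono) (auto simp: \<open>S \<ge> 0\<close>)
    then have "\<bar>x a * x b\<bar> \<le> S" using \<open>S \<ge> 0\<close> by simp
    then show "norm (G a b x) \<le> norm (indicator (coord_ball B) x :: real)"
      using \<open>S \<ge> 0\<close> by (auto simp: G_def S_def[symmetric] indicator_def divide_le_eq)
  qed
  show "integrable M (G a b)" by (rule int[OF a b])
  have inv: "integral\<^sup>L M (\<lambda>x. G c d (\<lambda>b\<in>B. s b * x (\<pi> b))) = integral\<^sup>L M (G c d)"
    if "\<And>b. b \<in> B \<Longrightarrow> \<pi> b \<in> B" "\<And>b. b \<in> B \<Longrightarrow> \<pi> (\<pi> b) = b"
      "\<And>b. b \<in> B \<Longrightarrow> s b = 1 \<or> s b = -1" "c \<in> B" "d \<in> B" for c d and s :: "'b \<Rightarrow> real" and \<pi>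
    using distr_PiM_lborel_signed_involution[of B \<pi> s, folded M_def, OF assms(1) that(1-3)]
      integral_distr[of "\<lambda>x. \<lambda>b\<in>B. s b * x (\<pi> b)" M M "G c d"] meas[OF that(4,5)] by simp
  have sum_inv: "(\<Sum>c\<in>B. ((\<lambda>b\<in>B. s b * x (\<pi> b)) c)\<^sup>2) = (\<Sum>c\<in>B. (x c)\<^sup>2)"
    if "\<And>b. b \<in> B \<Longrightarrow> \<pi> b \<in> B" "\<And>b. b \<in> B \<Longrightarrow> \<pi> (\<pi> b) = b"
      "\<And>b. b \<in> B \<Longrightarrow> s b = 1 \<or> s b = -1" for s :: "'b \<Rightarrow> real" and \<pi> x
  proof -
    have "(\<Sum>c\<in>B. ((\<lambda>b\<in>B. s b * x (\<pi> b)) c)\<^sup>2) = (\<Sum>c\<in>B. (x (\<pi> c))\<^sup>2)"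
      using that(3) by (intro sum.cong) (force simp: power_mult_distrib)+
    also have "\<dots> = (\<Sum>c\<in>B. (x c)\<^sup>2)"
      by (rule sum.reindex_bij_witness[of _ \<pi> \<pi>]) (use that in auto)
    finally show ?thesis .
  qed
  have ind_inv: "indicator (coord_ball B) (\<lambda>b\<in>B. s b * x (\<pi> b)) = (indicator (coord_ball B) x :: real)"
    if "\<And>b. b \<in> B \<Longrightarrow> \<pi> b \<in> B" "\<And>b. b \<in> B \<Longrightarrow> \<pi> (\<pi> b) = b"
      "\<And>b. b \<in> B \<Longrightarrow> s b = 1 \<or> s b = -1" "x \<in> space M" for s :: "'b \<Rightarrow> real" and \<pi> x
    using sum_inv[of \<pi> s x, OF that(1-3)] that(4)
    unfolding indicator_def coord_ball_def M_def by (auto simp: space_PiM PiE_def)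
  show "integral\<^sup>L M (G a b) = (if a = b then measure M (coord_ball B) / card B else 0)"
  proof (cases "a = b")
    case False
    let ?s = "\<lambda>c. if c = a then -1 else 1 :: real"
    have "integral\<^sup>L M (G a b) = integral\<^sup>L M (\<lambda>x. G a b (\<lambda>c\<in>B. ?s c * x (id c)))"
      using a b by (intro inv[symmetric]) auto
    also have "\<dots> = integral\<^sup>L M (\<lambda>x. - G a b x)"
    proof (rule Bochner_Integration.integral_cong[OF refl])
      fix x assume "x \<in> space M"
      then show "G a b (\<lambda>c\<in>B. ?s c * x (id c)) = - G a b x"
        using sum_inv[of id ?s x] ind_inv[of id ?s x] a b False
        unfolding G_def by simp
    qed
    finally show ?thesis using False by simp
  next
    case True
    have "integral\<^sup>L M (G c c) = integral\<^sup>L M (G a a)" if "c \<in> B" for c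
    proof -
      let ?p = "\<lambda>d. if d = a then c else if d = c then a else d"
      have "integral\<^sup>L M (G a a) = integral\<^sup>L M (\<lambda>x. G a a (\<lambda>d\<in>B. 1 * x (?p d)))"
        using a that by (intro inv[symmetric]) auto
      also have "\<dots> = integral\<^sup>L M (G c c)"
      proof (rule Bochner_Integration.integral_cong[OF refl])
        fix x assume "x \<in> space M"
        then show "G a a (\<lambda>d\<in>B. 1 * x (?p d)) = G c c x"
          using sum_inv[of ?p "\<lambda>_. 1" x] ind_inv[of ?p "\<lambda>_. 1" x] a that
          unfolding G_def by simp
      qed
      finally show ?thesis by simp
    qed
    then have "card B * integral\<^sup>L M (G a a) = (\<Sum>c\<in>B. integral\<^sup>L M (G c c))" by simp
    also have "\<dots> = integral\<^sup>L M (\<lambda>x. \<Sum>c\<in>B. G c c x)" using int by simp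
    also have "\<dots> = integral\<^sup>L M (indicator (coord_ball B))"
    proof (rule Bochner_Integration.integral_cong[OF refl])
      fix x
      have "(\<Sum>c\<in>B. G c c x) = indicator (coord_ball B) x * ((\<Sum>c\<in>B. (x c)\<^sup>2) / (\<Sum>c\<in>B. (x c)\<^sup>2))"
        unfolding G_def by (simp only: sum_distrib_left sum_divide_distrib power2_eq_square)
      also have "\<dots> = indicator (coord_ball B) x" by (auto simp: indicator_def coord_ball_def)
      finally show "(\<Sum>c\<in>B. G c c x) = indicator (coord_ball B) x" .
    qed
    also have "\<dots> = measure M (coord_ball B)"
      using sets.sets_into_space[OF coord_ball_sets[of B]] by (simp add: M_def Int_absorb2)
    finally show ?thesis using assms(1,2) True by (simp add: field_simps)
  qed
qed

lemma integral_sphere_measure: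
  fixes f :: "'a::euclidean_space \<Rightarrow> real"
  assumes f: "f \<in> borel_measurable borel"
  shows "(\<integral>v. f v \<partial>sphere_measure V) = dim V *
    (\<integral>x. indicator (cball 0 1) (\<Sum>b\<in>onb V. x b *\<^sub>R b) * f (sgn (\<Sum>b\<in>onb V. x b *\<^sub>R b))
      \<partial>(\<Pi>\<^sub>M b\<in>onb V. (lborel :: real measure)))"
proof -
  let ?L = "subspace_lborel V"
  let ?R = "distr (restrict_space ?L (cball 0 1)) borel sgn"
  have sL: "sets ?L = sets borel" by (simp add: subspace_lborel_def)
  have scale: "sphere_measure V = density ?R (\<lambda>_. ennreal (real (dim V)))"
    unfolding sphere_measure_def
    by (rule measure_eqI) (auto simp: emeasure_density_const ennreal_of_nat_eq_real_of_nat)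
  have sgn: "sgn \<in> measurable (restrict_space ?L (cball 0 1)) borel"
    using borel_measurable_sgn by (intro measurable_restrict_space1) (simp add: measurable_cong_sets[OF sL refl])
  have "(\<integral>v. f v \<partial>sphere_measure V) = dim V * (\<integral>v. f v \<partial>?R)"
    unfolding scale using f by (subst integral_density) auto
  also have "(\<integral>v. f v \<partial>?R) = (\<integral>w. f (sgn w) \<partial>restrict_space ?L (cball 0 1))"
    by (rule integral_distr[OF sgn f])
  also have "\<dots> = (\<integral>w. indicator (cball 0 1) w * f (sgn w) \<partial>?L)"
    by (subst integral_restrict_space) (auto simp: sL)
  also have "\<dots> = (\<integral>x. indicator (cball 0 1) (\<Sum>b\<in>onb V. x b *\<^sub>R b) * f (sgn (\<Sum>b\<in>onb V. x b *\<^sub>R b))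
      \<partial>(\<Pi>\<^sub>M b\<in>onb V. (lborel :: real measure)))"
    unfolding subspace_lborel_def
  proof (rule integral_distr)
    show "(\<lambda>x. \<Sum>b\<in>onb V. x b *\<^sub>R b) \<in> borel_measurable (\<Pi>\<^sub>M b\<in>onb V. (lborel :: real measure))"
      by measurable
    show "(\<lambda>w. indicator (cball 0 1) w * f (sgn w)) \<in> borel_measurable borel"
      using measurable_compose[OF borel_measurable_sgn f]
      by (intro borel_measurable_times borel_measurable_indicator) auto
  qed
  finally show ?thesis .
qed

text \<open>In polar coordinates with respect to an orthonormal basis, both the numerator and the denominator
  are multiples of the volume of the unit ball, which cancels.\<close>

lemma sphere_average_quadratic:
  fixes A :: "'a::euclidean_space \<Rightarrow> 'a"
  assumes "subspace V" "dim V > 0" and A: "linear A"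
  shows "(LINT v:unit_sphere V|sphere_measure V. A v \<bullet> v) / measure (sphere_measure V) (unit_sphere V) =
    (\<Sum>b\<in>onb V. A b \<bullet> b) / dim V"
proof -
  define B where "B = onb V"
  note o = onb[OF assms(1), folded B_def]
  have B: "finite B" "B \<noteq> {}" using o assms(2) by auto
  define M where "M = (\<Pi>\<^sub>M b\<in>B. (lborel :: real measure))"
  define w where "w = (\<lambda>x. \<Sum>b\<in>B. x b *\<^sub>R b)"
  define S where "S = (\<lambda>x. \<Sum>b\<in>B. (x b)\<^sup>2 :: real)"
  define vol where "vol = measure M (coord_ball B)"
  have vol: "vol > 0" using coord_ball_measure[OF B] by (simp add: vol_def M_def)
  have wV: "w x \<in> V" for x
    unfolding w_def using o(1) assms(1) by (intro subspace_sum subspace_scale) auto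
  have norm_w: "(norm (w x))\<^sup>2 = S x" for x
  proof -
    have "(norm (w x))\<^sup>2 = (\<Sum>a\<in>B. (norm (x a *\<^sub>R a))\<^sup>2)"
      unfolding w_def using o(2) B(1)
      by (intro norm_sum_Pythagorean) (auto simp: pairwise_def orthogonal_def)
    also have "\<dots> = S x" unfolding S_def using o(3) by (intro sum.cong) auto
    finally show ?thesis .
  qed
  have ball: "indicator (cball 0 1) (w x) * indicator (unit_sphere V) (sgn (w x)) =
      (indicator (coord_ball B) x :: real)" if "x \<in> space M" for x
  proof -
    have "w x \<noteq> 0 \<longleftrightarrow> 0 < S x" by (metis norm_w zero_less_power2 norm_eq_zero)
    moreover have "norm (w x) \<le> 1 \<longleftrightarrow> S x \<le> 1"
      unfolding norm_w[symmetric] by (simp add: abs_square_le_1)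
    moreover have "sgn (w x) \<in> unit_sphere V \<longleftrightarrow> w x \<noteq> 0"
      using wV[of x] assms(1) by (auto simp: unit_sphere_def sgn_div_norm subspace_scale)
    moreover have "x \<in> extensional B" using that by (simp add: M_def space_PiM PiE_iff)
    ultimately show ?thesis by (auto simp: indicator_def coord_ball_def S_def)
  qed
  have sph: "unit_sphere V \<in> sets borel"
  proof -
    have "unit_sphere V = V \<inter> sphere 0 1" by (auto simp: unit_sphere_def)
    then show ?thesis using closed_subspace[OF assms(1)] by (auto intro!: borel_closed)
  qed
  have contA: "continuous_on UNIV A"
    using A by (simp add: linear_continuous_on linear_conv_bounded_linear)
  have measA: "A \<in> borel_measurable borel" using contA by (rule borel_measurable_continuous_onI)
  have "(LINT v:unit_sphere V|sphere_measure V. A v \<bullet> v) =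
      (\<integral>v. indicator (unit_sphere V) v * (A v \<bullet> v) \<partial>sphere_measure V)"
    by (simp add: set_lebesgue_integral_def)
  also have "\<dots> = dim V * (\<integral>x. indicator (cball 0 1) (w x) *
      (indicator (unit_sphere V) (sgn (w x)) * (A (sgn (w x)) \<bullet> sgn (w x))) \<partial>M)"
    unfolding w_def M_def B_def using sph measA
    by (intro integral_sphere_measure borel_measurable_times borel_measurable_inner) auto
  also have "(\<integral>x. indicator (cball 0 1) (w x) *
      (indicator (unit_sphere V) (sgn (w x)) * (A (sgn (w x)) \<bullet> sgn (w x))) \<partial>M) =
      (\<integral>x. (\<Sum>a\<in>B. \<Sum>b\<in>B. (A a \<bullet> b) * (indicator (coord_ball B) x * (x a * x b / S x))) \<partial>M)"
  proof (rule Bochner_Integration.integral_cong[OF refl])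
    fix x assume x: "x \<in> space M"
    have "A (w x) = (\<Sum>a\<in>B. x a *\<^sub>R A a)"
      unfolding w_def by (simp add: linear_sum[OF A] linear_scale[OF A])
    then have "A (w x) \<bullet> w x = (\<Sum>a\<in>B. \<Sum>b\<in>B. (A a \<bullet> b) * (x a * x b))"
      unfolding w_def
      by (simp add: inner_sum_left inner_sum_right sum_distrib_left, subst sum.swap)
         (simp add: mult_ac)
    moreover have "A (sgn (w x)) \<bullet> sgn (w x) = (A (w x) \<bullet> w x) / S x"
      by (simp add: sgn_div_norm linear_scale[OF A] norm_w[symmetric] power2_eq_square field_simps)
    ultimately have "A (sgn (w x)) \<bullet> sgn (w x) = (\<Sum>a\<in>B. \<Sum>b\<in>B. (A a \<bullet> b) * (x a * x b / S x))"
      by (simp add: sum_divide_distrib)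
    then have "indicator (cball 0 1) (w x) *
        (indicator (unit_sphere V) (sgn (w x)) * (A (sgn (w x)) \<bullet> sgn (w x))) =
        indicator (coord_ball B) x * (\<Sum>a\<in>B. \<Sum>b\<in>B. (A a \<bullet> b) * (x a * x b / S x))"
      using ball[OF x] by (simp only: mult.assoc[symmetric])
    then show "indicator (cball 0 1) (w x) *
        (indicator (unit_sphere V) (sgn (w x)) * (A (sgn (w x)) \<bullet> sgn (w x))) =
        (\<Sum>a\<in>B. \<Sum>b\<in>B. (A a \<bullet> b) * (indicator (coord_ball B) x * (x a * x b / S x)))"
      by (simp add: sum_distrib_left mult.left_commute)
  qed
  also have "\<dots> = (\<Sum>a\<in>B. \<Sum>b\<in>B. (A a \<bullet> b) * (if a = b then vol / card B else 0))"
    using coord_ball_quadratic_integral[OF B, folded M_def vol_def]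
    by (simp add: S_def del: times_divide_eq_right)
  also have "\<dots> = (\<Sum>a\<in>B. A a \<bullet> a) * vol / card B"
    using B(1) by (simp add: if_distrib sum.delta' sum_distrib_right sum_divide_distrib cong: if_cong)
  finally have 1: "(LINT v:unit_sphere V|sphere_measure V. A v \<bullet> v) =
    dim V * ((\<Sum>a\<in>B. A a \<bullet> a) * vol / card B)" .
  have "space (sphere_measure V) = UNIV"
    by (simp add: sphere_measure_def space_scale_measure)
  then have "measure (sphere_measure V) (unit_sphere V) =
      (\<integral>v. indicator (unit_sphere V) v \<partial>sphere_measure V)" by simp
  also have "\<dots> = dim V * (\<integral>x. indicator (cball 0 1) (w x) * indicator (unit_sphere V) (sgn (w x)) \<partial>M)"
    unfolding w_def M_def B_def using sph by (intro integral_sphere_measure) auto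
  also have "(\<integral>x. indicator (cball 0 1) (w x) * indicator (unit_sphere V) (sgn (w x)) \<partial>M) =
      (\<integral>x. (indicator (coord_ball B) x :: real) \<partial>M)"
    by (rule Bochner_Integration.integral_cong[OF refl ball])
  also have "\<dots> = vol"
    using sets.sets_into_space[OF coord_ball_sets[of B]] by (simp add: M_def vol_def Int_absorb2)
  finally have 2: "measure (sphere_measure V) (unit_sphere V) = dim V * vol" .
  show ?thesis
    unfolding 1 2 using vol assms(2) o(6) by (simp add: B_def[symmetric])
qed

section \<open>Mean curvature of level sets and the gradient flow\<close>

lemma laplacian_eq_trace:
  fixes u :: "'a::euclidean_space \<Rightarrow> real"
  assumes "open \<Omega>" "x \<in> \<Omega>"
    and g: "\<And>x. x \<in> \<Omega> \<Longrightarrow> GDERIV u x :> g x"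
    and h: "(g has_derivative h) (at x)"
  shows "laplacian u x = (\<Sum>b\<in>Basis. h b \<bullet> b)"
  unfolding laplacian_def
proof (rule sum.cong[OF refl])
  fix b :: 'a assume "b \<in> Basis"
  have line: "((\<lambda>t. y + t *\<^sub>R b) has_vector_derivative b) (at t)" for y :: 'a and t
    by (auto intro!: derivative_eq_intros)
  have pd: "partial_deriv b u y = g y \<bullet> b" if "y \<in> \<Omega>" for y
    unfolding partial_deriv_def
    using has_vector_derivative_gradient_along[OF line, of u y 0 "g y"] g[OF that]
    by (intro DERIV_imp_deriv) (simp add: inner_commute)
  have "((\<lambda>t. g (x + t *\<^sub>R b)) has_vector_derivative h b) (at 0)"
    using has_vector_derivative_compose_along[OF line, of g h x 0] h by simp
  then have "((\<lambda>t. g (x + t *\<^sub>R b) \<bullet> b) has_real_derivative h b \<bullet> b) (at 0)"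
    by (auto simp: has_real_derivative_iff_has_vector_derivative
        intro: bounded_linear.has_vector_derivative[OF bounded_linear_inner_left])
  moreover have "open ((\<lambda>t. x + t *\<^sub>R b) -` \<Omega>)"
    using \<open>open \<Omega>\<close> by (intro open_vimage continuous_intros)
  ultimately have "((\<lambda>t. partial_deriv b u (x + t *\<^sub>R b)) has_real_derivative h b \<bullet> b) (at 0)"
    by (rule has_field_derivative_transform_within_open) (use \<open>x \<in> \<Omega>\<close> pd in auto)
  then show "partial_deriv b (partial_deriv b u) x = h b \<bullet> b"
    unfolding partial_deriv_def[of b "partial_deriv b u"] by (rule DERIV_imp_deriv)
qed

text \<open>The traces of the Hessian over the tangent space and over the normal line add up to the Laplacian,
  so for a trace-free Hessian the tangential trace is \<open>- (h q N \<bullet> N)\<close>.\<close>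

lemma mean_curvature_trace_free:
  fixes u :: "'a::euclidean_space \<Rightarrow> real"
  assumes "open \<Omega>" "q \<in> \<Omega>"
    and g: "\<And>x. x \<in> \<Omega> \<Longrightarrow> GDERIV u x :> g x"
    and h: "\<And>x. x \<in> \<Omega> \<Longrightarrow> (g has_derivative h x) (at x)"
    and gq: "g q \<noteq> 0" and dim: "DIM('a) \<ge> 2"
    and tr: "(\<Sum>b\<in>Basis. h q b \<bullet> b) = 0"
  defines "N \<equiv> unit_normal u q"
  shows "(real DIM('a) - 1) * mean_curvature \<Omega> u q = (h q N \<bullet> N) / norm (g q)"
proof -
  have N: "N = g q /\<^sub>R norm (g q)"
    using grad_eqI[OF g[OF \<open>q \<in> \<Omega>\<close>]] by (simp add: N_def unit_normal_def)
  then have normN: "norm N = 1" using gq by simp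
  then have NN: "N \<bullet> N = 1" by (simp add: norm_eq_1)
  define T where "T = tangent_space u q"
  have T: "T = {v. N \<bullet> v = 0}" by (simp add: T_def tangent_space_def N_def inner_commute)
  have sub: "subspace T" unfolding T by (rule subspace_hyperplane)
  have dimT: "dim T = DIM('a) - 1"
    unfolding T using normN by (intro dim_hyperplane) auto
  note o = onb[OF sub]
  have lin: "linear (h q)" using h[OF \<open>q \<in> \<Omega>\<close>] by (rule has_derivative_linear)
  define A where "A = (\<lambda>v. (- 1 / norm (g q)) *\<^sub>R h q v)"
  have linA: "linear A" unfolding A_def by (rule linear_compose_scale_right[OF lin])
  have "N \<notin> onb T" using o(1) NN unfolding T by auto
  have spanC: "span (insert N (onb T)) = UNIV"
  proof (intro UNIV_eq_I[symmetric])
    fix x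
    have "x - (x \<bullet> N) *\<^sub>R N \<in> T" by (simp add: T inner_diff_right inner_commute NN)
    then have "x - (x \<bullet> N) *\<^sub>R N \<in> span (onb T)" by (simp add: o(4))
    then show "x \<in> span (insert N (onb T))" unfolding span_breakdown_eq by blast
  qed
  have "0 = (\<Sum>c\<in>insert N (onb T). h q c \<bullet> c)"
  proof (subst trace_orthonormal_basis[OF lin _ _ _ spanC, symmetric])
    show "pairwise orthogonal (insert N (onb T))"
      using o(1,2) unfolding pairwise_insert T by (auto simp: orthogonal_def inner_commute)
  qed (use o normN tr in auto)
  also have "\<dots> = h q N \<bullet> N + (\<Sum>c\<in>onb T. h q c \<bullet> c)" using \<open>N \<notin> onb T\<close> o(5) by simp
  finally have "(\<Sum>c\<in>onb T. h q c \<bullet> c) = - (h q N \<bullet> N)" by simp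
  then have sumA: "(\<Sum>c\<in>onb T. A c \<bullet> c) = (h q N \<bullet> N) / norm (g q)"
    by (simp add: A_def sum_negf sum_divide_distrib[symmetric])
  have "(LINT v:unit_sphere T|sphere_measure T. normal_curvature \<Omega> u q v) =
      (LINT v:unit_sphere T|sphere_measure T. A v \<bullet> v)"
    unfolding set_lebesgue_integral_def
  proof (rule Bochner_Integration.integral_cong[OF refl])
    fix v
    have "normal_curvature \<Omega> u q v = A v \<bullet> v" if "v \<in> unit_sphere T"
    proof -
      have "norm v = 1" "v \<bullet> g q = 0"
        using that gq by (auto simp: unit_sphere_def T N inner_commute)
      then show ?thesis
        using normal_curvature_eq[OF assms(1-5)] by (simp add: A_def)
    qed
    then show "indicat_real (unit_sphere T) v *\<^sub>R normal_curvature \<Omega> u q v =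
        indicat_real (unit_sphere T) v *\<^sub>R (A v \<bullet> v)" by (auto simp: indicator_def)
  qed
  then have "mean_curvature \<Omega> u q = (h q N \<bullet> N) / norm (g q) / dim T"
    using sphere_average_quadratic[OF sub _ linA] dim dimT sumA
    by (simp add: mean_curvature_def Let_def T_def[symmetric])
  then show ?thesis using dim dimT by (simp add: of_nat_diff)
qed

theorem mainTheorem1:
  fixes \<Omega> :: "(real ^ 'n) set" and u :: "real ^ 'n \<Rightarrow> real"
    and p0 p :: "real ^ 'n" and \<phi> :: "real \<Rightarrow> real ^ 'n" and l :: real
  assumes "CARD('n) \<ge> 2"
    and "open \<Omega>" and "connected \<Omega>"
    and "harmonic_on \<Omega> u"
    and "\<And>q. q \<in> \<Omega> \<Longrightarrow> grad u q \<noteq> 0"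
    and "p0 \<in> \<Omega>"
    and "0 \<le> l" and "gradient_flow \<Omega> u p0 l \<phi>" and "p = \<phi> l"
  shows "(\<lambda>s. mean_curvature \<Omega> u (\<phi> s)) integrable_on {0..l} \<and>
    norm (grad u p) = norm (grad u p0) *
      exp ((real CARD('n) - 1) * integral {0..l} (\<lambda>s. mean_curvature \<Omega> u (\<phi> s)))"
proof -
  obtain g :: "real ^ 'n \<Rightarrow> real ^ 'n" and h :: "real ^ 'n \<Rightarrow> (real ^ 'n) \<Rightarrow>\<^sub>L (real ^ 'n)"
    where g: "\<And>x. x \<in> \<Omega> \<Longrightarrow> GDERIV u x :> g x"
      and h: "\<And>x. x \<in> \<Omega> \<Longrightarrow> (g has_derivative h x) (at x)"
    using \<open>harmonic_on \<Omega> u\<close> unfolding harmonic_on_def C2_on_def by blast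
  have grad: "grad u x = g x" "g x \<noteq> 0" if "x \<in> \<Omega>" for x
    using grad_eqI[OF g[OF that]] assms(5)[OF that] by auto
  have flow: "\<phi> 0 = p0" "\<And>s. s \<in> {0..l} \<Longrightarrow> \<phi> s \<in> \<Omega>"
    "\<And>s. s \<in> {0..l} \<Longrightarrow> (\<phi> has_vector_derivative unit_normal u (\<phi> s)) (at s within {0..l})"
    using assms(8) unfolding gradient_flow_def by auto
  define c where "c = real CARD('n) - 1"
  have "c > 0" using assms(1) by (simp add: c_def)
  define H where "H = (\<lambda>s. mean_curvature \<Omega> u (\<phi> s))"
  define L where "L = (\<lambda>s. ln (norm (g (\<phi> s))))"
  have dL: "(L has_vector_derivative c * H s) (at s within {0..l})" if s: "s \<in> {0..l}" for s
  proof -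
    let ?q = "\<phi> s" and ?N = "unit_normal u (\<phi> s)"
    have q: "?q \<in> \<Omega>" "g ?q \<noteq> 0" using flow(2)[OF s] grad(2) by auto
    have tr: "(\<Sum>b\<in>Basis. h ?q b \<bullet> b) = 0"
      using laplacian_eq_trace[OF \<open>open \<Omega>\<close> q(1) g h[OF q(1)]] \<open>harmonic_on \<Omega> u\<close> q(1)
      by (simp add: harmonic_on_def)
    have N: "?N = sgn (g ?q)" using grad(1)[OF q(1)] by (simp add: unit_normal_def sgn_div_norm)
    have cH: "c * H s = (h ?q ?N \<bullet> ?N) / norm (g ?q)"
      using mean_curvature_trace_free[OF \<open>open \<Omega>\<close> q(1) g h q(2) _ tr] assms(1)
      by (simp add: c_def H_def)
    have "((\<lambda>s. g (\<phi> s)) has_vector_derivative h ?q ?N) (at s within {0..l})"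
      by (rule has_vector_derivative_compose_along[OF flow(3)[OF s] h[OF q(1)]])
    from has_vector_derivative_compose_along[where \<gamma> = "\<lambda>s. g (\<phi> s)", OF this has_derivative_norm[OF q(2)]]
    have "((\<lambda>s. norm (g (\<phi> s))) has_real_derivative h ?q ?N \<bullet> ?N) (at s within {0..l})"
      by (simp add: has_real_derivative_iff_has_vector_derivative N)
    then have "(L has_real_derivative (h ?q ?N \<bullet> ?N) / norm (g ?q)) (at s within {0..l})"
      unfolding L_def using q(2) by (auto intro!: derivative_eq_intros)
    then show ?thesis by (simp add: cH has_real_derivative_iff_has_vector_derivative)
  qed
  have "((\<lambda>s. c * H s) has_integral (L l - L 0)) {0..l}"
    by (rule fundamental_theorem_of_calculus[OF \<open>0 \<le> l\<close> dL])
  then have "((\<lambda>s. inverse c * (c * H s)) has_integral inverse c * (L l - L 0)) {0..l}"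
    by (rule has_integral_mult_right)
  then have int: "(H has_integral inverse c * (L l - L 0)) {0..l}"
    using \<open>c > 0\<close> by (simp add: mult.assoc[symmetric])
  have "c * integral {0..l} H = L l - L 0"
    using integral_unique[OF int] \<open>c > 0\<close> by simp
  then have "norm (g (\<phi> 0)) * exp (c * integral {0..l} H) = norm (g (\<phi> l))"
    using grad(2)[OF flow(2), of 0] grad(2)[OF flow(2), of l] \<open>0 \<le> l\<close>
    by (simp add: L_def exp_diff)
  then show ?thesis
    using int grad(1)[OF flow(2), of 0] grad(1)[OF flow(2), of l] \<open>0 \<le> l\<close> flow(1) assms(9)
    by (auto simp: H_def c_def integrable_on_def)
qed

end
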